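(* Fix a feature dimension $F\ge 1$. Let NCN be the model class whose representation of a link $(i,j)$ in a graph $(A,X)$ is $$\mathrm{NCN}(i,j,A,X)=\mathrm{MPNN}(i,A,X)\odot \mathrm{MPNN}(j,A,X)\,\Big\|\,\sum_{u\in N(i)\cap N(j)} \mathrm{MPNN}(u,A,X),$$ where $\mathrm{MPNN}$ is any message passing neural network and $\|$ denotes concatenation. Then NCN is strictly more expressive than each of GAE, CN, RA and AA. Moreover, Neo-GNN is not more expressive than NCN, and BUDDY is not more expressive than NCN.
   Context: Graphs. A graph is an undirected graph on $V=\{1,\dots,n\}$ ($n$ arbitrary) with symmetric adjacency matrix $A\in\{0,1\}^{n\times n}$ and node feature matrix $X\in\mathbb{R}^{n\times F}$, whose $v$-th row $X_v$ is the feature of node $v$. Write $N(u)=\{v: A_{uv}>0\}$ and $d(u)=\sum_v A_{uv}$. For $l\ge1$, $A^{l}$ is the $l$-th matrix power (its $(u,v)$ entry counts walks of length $l$), regarded also as a graph in which $u,v$ are adjacent iff $(A^l)_{uv}>0$. $N_{l_1}^{l_2}(u)$ is the set of nodes at shortest-path distance exactly $l_1$ from $u$ in the graph $A^{l_2}$. A link is a pair of distinct nodes $(i,j)$ in a graph $(A,X)$. $\odot$ is the entrywise product. MPNN. A message passing neural network with $K$ layers sets $h_v^{(0)}=X_v$ and $$h_v^{(k)}=U^{(k)}\Big(h_v^{(k-1)},\mathrm{AGG}\big(\{\!\!\{M^{(k)}(h_v^{(k-1)},h_u^{(k-1)}): u\in N(v)\}\!\!\}\big)\Big),\quad k=1,\dots,K,$$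 with arbitrary functions $U^{(k)},M^{(k)}$ between finite-dimensional real vector spaces and $\mathrm{AGG}$ a permutation-invariant function of finite multisets (such as sum or max); $\mathrm{MPNN}(v,A,X)=h_v^{(K)}$. $K$, the dimensions and the functions are the free parameters; within one link representation the same MPNN is used throughout. Models (output on link $(i,j)$ in $(A,X)$): - GAE: $\langle \mathrm{MPNN}(i,A,X),\mathrm{MPNN}(j,A,X)\rangle$. - CN: $\sum_{u\in N(i)\cap N(j)}1$. RA: $\sum_{u\in N(i)\cap N(j)}\frac1{d(u)}$. AA: $\sum_{u\in N(i)\cap N(j)}\frac1{\log d(u)}$. - Neo-GNN: $\mathrm{MPNN}(i,A,X)\odot\mathrm{MPNN}(j,A,X)$ concatenated with finitely many features $\sum_{u\in N_1^{l_1}(i)\cap N_1^{l_2}(j)} (A^{l_1})_{iu}(A^{l_2})_{ju}\,f(d(u))$, with $f$ an arbitrary (learnable) function and $l_1,l_2\ge1$. - BUDDY: for some $k\ge1$, $\mathrm{MPNN}(i,A,X)\odot\mathrm{MPNN}(j,A,X)$ concatenated with $a_{l_1,l_2}(i,j)=|N_{l_1}^1(i)\cap N_{l_2}^1(j)|$ for $l_1,l_2=1,\dots,k$, and $b_l(i,j)=|N_l^1(i)\setminus\bigcup_{l'=1}^k N_{l'}^1(j)|$ and $b_l(j,i)$ for $l=1,\dots,k$. Expressivity. A model class differentiates (distinguishes) two links (possibly in different graphs with feature dimension $F$) if for some choice of its free parameters and hyperparameters its outputs on the two links differ. Model A is more expressive than model B if A differentiates every pair of links that B differentiates. A is strictly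 more expressive than B if A is more expressive than B and there is a pair of links that A differentiates but B does not. *)

theory Defs
  imports Complex_Main "HOL-Library.Multiset" "HOL-Library.Extended_Nat"
    "Jordan_Normal_Form.Matrix"
begin

text \<open>
  The node set of a graph is \<open>{0..<n}\<close>, matching the indices of \<^typ>\<open>'a mat\<close>. Adjacency matrices
  have natural number entries, so that matrix powers count walks. Self-loops are not excluded.
\<close>

type_synonym lgraph = "nat mat \<times> real mat"

text \<open>A link carries the graph it lives in: \<open>((A, X), i, j)\<close>.\<close>

type_synonym link = "lgraph \<times> nat \<times> nat"

definition graphs :: "nat \<Rightarrow> lgraph set" where
  "graphs F = {(A, X). \<exists>n. A \<in> carrier_mat n n \<and> X \<in> carrier_mat n F \<and>
     elements_mat A \<subseteq> {0, 1} \<and> transpose_mat A = A}"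

definition links :: "nat \<Rightarrow> link set" where
  "links F = {((A, X), i, j). (A, X) \<in> graphs F \<and> i < dim_row A \<and> j < dim_row A \<and> i \<noteq> j}"

definition nbrs :: "nat mat \<Rightarrow> nat \<Rightarrow> nat set" where
  "nbrs A u = {v. v < dim_row A \<and> A $$ (u, v) > 0}"

definition degree :: "nat mat \<Rightarrow> nat \<Rightarrow> nat" where
  "degree A u = (\<Sum>v<dim_row A. A $$ (u, v))"

text \<open>
  A matrix is read as the graph whose edges are its positive entries; distances are lengths of
  shortest walks, and \<open>\<infinity>\<close> if there is none.
\<close>

definition edge_rel :: "nat mat \<Rightarrow> (nat \<times> nat) set" where
  "edge_rel B = {(u, v). u < dim_row B \<and> v < dim_row B \<and> B $$ (u, v) > 0}"

definition sp_dist :: "nat mat \<Rightarrow> nat \<Rightarrow> nat \<Rightarrow> enat" where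
  "sp_dist B u v = Inf {enat m | m. (u, v) \<in> edge_rel B ^^ m}"

text \<open>\<open>sphere A l1 l2 u\<close>: the nodes at distance exactly \<open>l1\<close> from \<open>u\<close> in the graph \<open>A ^\<^sub>m l2\<close>.\<close>

definition sphere :: "nat mat \<Rightarrow> nat \<Rightarrow> nat \<Rightarrow> nat \<Rightarrow> nat set" where
  "sphere A l1 l2 u = {v. v < dim_row A \<and> sp_dist (A ^\<^sub>m l2) u v = enat l1}"

text \<open>
  Dimensions live in the carriers, so the functions of a network are typed by \<open>mpnn_wf\<close>:
  \<open>hdim k\<close> and \<open>mdim k\<close> are the dimensions of \<open>h\<^sup>k\<close> and of the messages of layer \<open>k\<close>.
  One aggregator serves all layers. It is a family indexed by the message dimension \<open>e\<close>,
  with values in dimension \<open>adim e\<close>, because e.g. the sum of the empty multiset depends on \<open>e\<close>.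
\<close>

record mpnn =
  depth :: nat
  hdim :: "nat \<Rightarrow> nat"
  mdim :: "nat \<Rightarrow> nat"
  adim :: "nat \<Rightarrow> nat"
  msg :: "nat \<Rightarrow> real vec \<Rightarrow> real vec \<Rightarrow> real vec"
  agg :: "nat \<Rightarrow> real vec multiset \<Rightarrow> real vec"
  upd :: "nat \<Rightarrow> real vec \<Rightarrow> real vec \<Rightarrow> real vec"

definition mpnn_wf :: "nat \<Rightarrow> mpnn \<Rightarrow> bool" where
  "mpnn_wf F P \<longleftrightarrow>
     hdim P 0 = F \<and>
     (\<forall>k\<in>{1..depth P}.
        msg P k \<in> carrier_vec (hdim P (k - 1)) \<rightarrow> carrier_vec (hdim P (k - 1)) \<rightarrow>
          carrier_vec (mdim P k) \<and>
        upd P k \<in> carrier_vec (hdim P (k - 1)) \<rightarrow> carrier_vec (adim P (mdim P k)) \<rightarrow>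
          carrier_vec (hdim P k)) \<and>
     (\<forall>e. agg P e \<in> {S. set_mset S \<subseteq> carrier_vec e} \<rightarrow> carrier_vec (adim P e))"

primrec mpnn_hidden :: "mpnn \<Rightarrow> lgraph \<Rightarrow> nat \<Rightarrow> nat \<Rightarrow> real vec" where
  "mpnn_hidden P G 0 v = row (snd G) v"
| "mpnn_hidden P G (Suc k) v =
     upd P (Suc k) (mpnn_hidden P G k v)
       (agg P (mdim P (Suc k))
         {# msg P (Suc k) (mpnn_hidden P G k v) (mpnn_hidden P G k u).
            u \<in># mset_set (nbrs (fst G) v) #})"

definition mpnn_out :: "mpnn \<Rightarrow> lgraph \<Rightarrow> nat \<Rightarrow> real vec" where
  "mpnn_out P G v = mpnn_hidden P G (depth P) v"

definition hadamard :: "real vec \<Rightarrow> real vec \<Rightarrow> real vec" where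
  "hadamard x y = vec (dim_vec x) (\<lambda>k. x $ k * y $ k)"

text \<open>
  A model class is the set of link functions obtained from all choices of its parameters
  and hyperparameters.
\<close>

definition gae :: "nat \<Rightarrow> (link \<Rightarrow> real) set" where
  "gae F = {\<lambda>(G, i, j). mpnn_out P G i \<bullet> mpnn_out P G j | P. mpnn_wf F P}"

definition cn :: "(link \<Rightarrow> real) set" where
  "cn = {\<lambda>((A, X), i, j). \<Sum>u\<in>nbrs A i \<inter> nbrs A j. 1}"

definition ra :: "(link \<Rightarrow> real) set" where
  "ra = {\<lambda>((A, X), i, j). \<Sum>u\<in>nbrs A i \<inter> nbrs A j. 1 / real (degree A u)}"

definition aa :: "(link \<Rightarrow> real) set" where
  "aa = {\<lambda>((A, X), i, j). \<Sum>u\<in>nbrs A i \<inter> nbrs A j. 1 / ln (real (degree A u))}"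

definition ncn :: "nat \<Rightarrow> (link \<Rightarrow> real vec) set" where
  "ncn F = {\<lambda>((A, X), i, j).
     hadamard (mpnn_out P (A, X) i) (mpnn_out P (A, X) j) @\<^sub>v
     finsum_vec TYPE(real) (hdim P (depth P)) (mpnn_out P (A, X)) (nbrs A i \<inter> nbrs A j)
     | P. mpnn_wf F P}"

definition neo_feature :: "nat mat \<Rightarrow> nat \<Rightarrow> nat \<Rightarrow> nat \<times> nat \<times> (nat \<Rightarrow> real) \<Rightarrow> real" where
  "neo_feature A i j = (\<lambda>(l1, l2, f).
     \<Sum>u\<in>sphere A 1 l1 i \<inter> sphere A 1 l2 j.
       real ((A ^\<^sub>m l1) $$ (i, u)) * real ((A ^\<^sub>m l2) $$ (j, u)) * f (degree A u))"

definition neo_gnn :: "nat \<Rightarrow> (link \<Rightarrow> real vec) set" where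
  "neo_gnn F = {\<lambda>((A, X), i, j).
     hadamard (mpnn_out P (A, X) i) (mpnn_out P (A, X) j) @\<^sub>v
     vec_of_list (map (neo_feature A i j) fs)
     | P fs. mpnn_wf F P \<and> (\<forall>(l1, l2, f)\<in>set fs. l1 \<ge> 1 \<and> l2 \<ge> 1)}"

definition buddy_a :: "nat mat \<Rightarrow> nat \<Rightarrow> nat \<Rightarrow> nat \<Rightarrow> nat \<Rightarrow> nat" where
  "buddy_a A i j l1 l2 = card (sphere A l1 1 i \<inter> sphere A l2 1 j)"

definition buddy_b :: "nat mat \<Rightarrow> nat \<Rightarrow> nat \<Rightarrow> nat \<Rightarrow> nat \<Rightarrow> nat" where
  "buddy_b A k i j l = card (sphere A l 1 i - (\<Union>l'\<in>{1..k}. sphere A l' 1 j))"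

definition buddy :: "nat \<Rightarrow> (link \<Rightarrow> real vec) set" where
  "buddy F = {\<lambda>((A, X), i, j).
     hadamard (mpnn_out P (A, X) i) (mpnn_out P (A, X) j) @\<^sub>v
     vec_of_list (map real
       ([buddy_a A i j l1 l2. l1 \<leftarrow> [1..<Suc k], l2 \<leftarrow> [1..<Suc k]] @
        [buddy_b A k i j l. l \<leftarrow> [1..<Suc k]] @
        [buddy_b A k j i l. l \<leftarrow> [1..<Suc k]]))
     | P k. mpnn_wf F P \<and> k \<ge> 1}"

definition differentiates :: "('l \<Rightarrow> 'o) set \<Rightarrow> 'l \<Rightarrow> 'l \<Rightarrow> bool" where
  "differentiates C x y \<longleftrightarrow> (\<exists>m\<in>C. m x \<noteq> m y)"

definition more_expressive :: "'l set \<Rightarrow> ('l \<Rightarrow> 'o) set \<Rightarrow> ('l \<Rightarrow> 'p) set \<Rightarrow> bool" where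
  "more_expressive L C D \<longleftrightarrow>
     (\<forall>x\<in>L. \<forall>y\<in>L. differentiates D x y \<longrightarrow> differentiates C x y)"

definition strictly_more_expressive :: "'l set \<Rightarrow> ('l \<Rightarrow> 'o) set \<Rightarrow> ('l \<Rightarrow> 'p) set \<Rightarrow> bool" where
  "strictly_more_expressive L C D \<longleftrightarrow>
     more_expressive L C D \<and>
     (\<exists>x\<in>L. \<exists>y\<in>L. differentiates C x y \<and> \<not> differentiates D x y)"

end

theory Submission
  imports Defs
begin

text \<open>
  NCN simulates GAE because an inner product is the sum of the entries of the Hadamard product, and
  it simulates CN, RA and AA because one layer whose aggregator counts messages computes any function
  of the degree. All four strictness claims, and both negative claims, are witnessed by one pair of links:
  in the cycle \<open>0, \<dots>, 7\<close> give the odd nodes alternately the features \<open>1\<close> and \<open>0\<close>, in the two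
  possible ways, and take the link \<open>(0, 2)\<close>. Every even node has one neighbour of either feature, so
  in both graphs the even nodes get the same MPNN value; all purely structural features agree as the
  graphs only differ in \<open>X\<close>. But the only common neighbour of \<open>0\<close> and \<open>2\<close> has feature \<open>1\<close> in one
  graph and \<open>0\<close> in the other.
\<close>

section \<open>Degrees and dimensions of network states\<close>

lemma finite_nbrs [simp]: "finite (nbrs A u)"
  by (simp add: nbrs_def)

lemma graphsD:
  assumes "(A, X) \<in> graphs F"
  shows "dim_col A = dim_row A" "X \<in> carrier_mat (dim_row A) F"
    "elements_mat A \<subseteq> {0, 1}"
  using assms by (auto simp: graphs_def)

text \<open>Entries are 0 or 1, so the row sum counts the nonzero entries. This ties
  \<open>degree\<close> to the number of messages a node receives.\<close>

lemma degree_eq_card_nbrs: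
  assumes "(A, X) \<in> graphs F" "u < dim_row A"
  shows "degree A u = card (nbrs A u)"
proof -
  have "A $$ (u, v) = (if v \<in> nbrs A u then 1 else 0)" if "v < dim_row A" for v
  proof -
    have "A $$ (u, v) \<in> elements_mat A"
      using graphsD(1)[OF assms(1)] assms(2) that
      by (intro elements_matI[of A "dim_row A" "dim_row A"]) auto
    then show ?thesis
      using graphsD(3)[OF assms(1)] that by (auto simp: nbrs_def)
  qed
  then have "degree A u = (\<Sum>v<dim_row A. if v \<in> nbrs A u then 1 else 0)"
    by (simp add: degree_def)
  also have "\<dots> = card ({..<dim_row A} \<inter> nbrs A u)"
    by (simp add: sum.If_cases)
  also have "{..<dim_row A} \<inter> nbrs A u = nbrs A u"
    by (auto simp: nbrs_def)
  finally show ?thesis .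
qed

lemma mpnn_hidden_carrier:
  assumes "(A, X) \<in> graphs F" "mpnn_wf F P" "v < dim_row A" "k \<le> depth P"
  shows "mpnn_hidden P (A, X) k v \<in> carrier_vec (hdim P k)"
  using assms(3,4)
proof (induction k arbitrary: v)
  case 0
  then show ?case
    using assms graphsD(2)[OF assms(1)] by (auto simp: mpnn_wf_def)
next
  case (Suc k)
  have k: "Suc k \<in> {1..depth P}"
    using Suc.prems by simp
  have h: "mpnn_hidden P (A, X) k u \<in> carrier_vec (hdim P k)" if "u < dim_row A" for u
    using Suc that by simp
  have msg: "msg P (Suc k) \<in> carrier_vec (hdim P k) \<rightarrow> carrier_vec (hdim P k) \<rightarrow>
      carrier_vec (mdim P (Suc k))"
    and upd: "upd P (Suc k) \<in> carrier_vec (hdim P k) \<rightarrow>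
      carrier_vec (adim P (mdim P (Suc k))) \<rightarrow> carrier_vec (hdim P (Suc k))"
    using assms(2)[unfolded mpnn_wf_def, THEN conjunct2, THEN conjunct1, THEN bspec, OF k]
    by simp_all
  have agg: "agg P e \<in> {S. set_mset S \<subseteq> carrier_vec e} \<rightarrow> carrier_vec (adim P e)" for e
    using assms(2) by (simp add: mpnn_wf_def)
  let ?S = "{# msg P (Suc k) (mpnn_hidden P (A, X) k v) (mpnn_hidden P (A, X) k u).
      u \<in># mset_set (nbrs A v) #}"
  have "set_mset ?S \<subseteq> carrier_vec (mdim P (Suc k))"
    using msg h Suc.prems by (auto simp: nbrs_def Pi_iff)
  then have "agg P (mdim P (Suc k)) ?S \<in> carrier_vec (adim P (mdim P (Suc k)))"
    using agg by blast
  then show ?case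
    using upd h[OF Suc.prems(1)] by (auto simp: Pi_iff)
qed

lemma mpnn_out_carrier:
  assumes "(A, X) \<in> graphs F" "mpnn_wf F P" "v < dim_row A"
  shows "mpnn_out P (A, X) v \<in> carrier_vec (hdim P (depth P))"
  unfolding mpnn_out_def using mpnn_hidden_carrier[OF assms] by simp

section \<open>Coordinates of the NCN representation\<close>

definition ncn_repr :: "mpnn \<Rightarrow> link \<Rightarrow> real vec" where
  "ncn_repr P = (\<lambda>((A, X), i, j).
     hadamard (mpnn_out P (A, X) i) (mpnn_out P (A, X) j) @\<^sub>v
     finsum_vec TYPE(real) (hdim P (depth P)) (mpnn_out P (A, X)) (nbrs A i \<inter> nbrs A j))"

lemma ncn_reprI:
  assumes "mpnn_wf F P" "ncn_repr P x \<noteq> ncn_repr P y"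
  shows "differentiates (ncn F) x y"
  proof -
  have "ncn_repr P \<in> ncn F"
    using assms(1) unfolding ncn_def ncn_repr_def by blast
  then show ?thesis
    using assms(2) unfolding differentiates_def by blast
qed

lemma ncn_repr_hadamard:
  assumes "mpnn_wf F P" "((A, X), i, j) \<in> links F" "k < hdim P (depth P)"
  shows "ncn_repr P ((A, X), i, j) $ k = mpnn_out P (A, X) i $ k * mpnn_out P (A, X) j $ k"
  using assms mpnn_out_carrier[of A X F P i] by (simp add: links_def ncn_repr_def hadamard_def)

lemma ncn_repr_sum:
  assumes "mpnn_wf F P" "((A, X), i, j) \<in> links F" "k < hdim P (depth P)"
  shows "ncn_repr P ((A, X), i, j) $ (hdim P (depth P) + k) =
    (\<Sum>u\<in>nbrs A i \<inter> nbrs A j. mpnn_out P (A, X) u $ k)"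
proof -
  let ?d = "hdim P (depth P)"
  have G: "(A, X) \<in> graphs F" and i: "i < dim_row A"
    using assms(2) by (auto simp: links_def)
  have out: "mpnn_out P (A, X) \<in> nbrs A i \<inter> nbrs A j \<rightarrow> carrier_vec ?d"
    using mpnn_out_carrier[OF G assms(1)] by (auto simp: nbrs_def)
  \<comment> \<open>Indexing into the second block of \<open>@\<^sub>v\<close> requires the
    dimension of that block.\<close>
  have "finsum_vec TYPE(real) ?d (mpnn_out P (A, X)) (nbrs A i \<inter> nbrs A j) \<in> carrier_vec ?d"
    using out by (intro finsum_vec_closed) auto
  then show ?thesis
    using assms(3) out mpnn_out_carrier[OF G assms(1) i]
    by (simp add: ncn_repr_def hadamard_def index_finsum_vec)
qed

section \<open>Simulation of GAE, CN, RA and AA\<close>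

lemma ncn_more_expressive_gae: "more_expressive (links F) (ncn F) (gae F)"
  unfolding more_expressive_def
proof (intro ballI impI)
  fix x y assume x: "x \<in> links F" and y: "y \<in> links F" and "differentiates (gae F) x y"
  then obtain m where "m \<in> gae F" and neq: "m x \<noteq> m y"
    by (auto simp: differentiates_def)
  then obtain P where P: "mpnn_wf F P"
    and m: "m = (\<lambda>(G, i, j). mpnn_out P G i \<bullet> mpnn_out P G j)"
    by (auto simp: gae_def)
  have "m z = (\<Sum>k<hdim P (depth P). ncn_repr P z $ k)" if "z \<in> links F" for z
  proof -
    obtain A X i j where z: "z = ((A, X), i, j)"
      by (cases z) auto
    \<comment> \<open>The index range of a scalar product is the dimension of its second
      argument.\<close>
    have "mpnn_out P (A, X) j \<in> carrier_vec (hdim P (depth P))"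
      using that P by (intro mpnn_out_carrier) (auto simp: z links_def)
    then show ?thesis
      using that P by (simp add: m z ncn_repr_hadamard scalar_prod_def lessThan_atLeast0)
  qed
  then have "ncn_repr P x \<noteq> ncn_repr P y"
    using neq x y by metis
  then show "differentiates (ncn F) x y"
    by (rule ncn_reprI[OF P])
qed

text \<open>Messages are the empty vector, so a multiset of them carries only its size, the number
  of neighbours; the update forgets the old state and applies \<open>f\<close>.\<close>

definition degree_mpnn :: "nat \<Rightarrow> (real \<Rightarrow> real) \<Rightarrow> mpnn" where
  "degree_mpnn F f = \<lparr>depth = 1, hdim = (\<lambda>k. if k = 0 then F else 1), mdim = (\<lambda>_. 0),
     adim = (\<lambda>_. 1), msg = (\<lambda>_ _ _. 0\<^sub>v 0), agg = (\<lambda>_ S. vec 1 (\<lambda>_. real (size S))),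
     upd = (\<lambda>_ _ a. vec 1 (\<lambda>_. f (a $ 0)))\<rparr>"

lemma degree_mpnn_wf: "mpnn_wf F (degree_mpnn F f)"
  by (auto simp: mpnn_wf_def degree_mpnn_def)

lemma degree_mpnn_out:
  assumes "(A, X) \<in> graphs F" "u < dim_row A"
  shows "mpnn_out (degree_mpnn F f) (A, X) u $ 0 = f (real (degree A u))"
  using degree_eq_card_nbrs[OF assms] by (simp add: mpnn_out_def degree_mpnn_def)

text \<open>CN, RA and AA are the instances with \<open>f d\<close> equal to 1, \<open>1 / d\<close>
  and \<open>1 / ln d\<close>.\<close>

lemma ncn_more_expressive_degree:
  fixes f :: "real \<Rightarrow> real"
  shows "more_expressive (links F) (ncn F)
     {\<lambda>((A, X), i, j). \<Sum>u\<in>nbrs A i \<inter> nbrs A j. f (real (degree A u))}"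
  (is "more_expressive _ _ {?m}")
  unfolding more_expressive_def
proof (intro ballI impI)
  fix x y assume x: "x \<in> links F" and y: "y \<in> links F" and "differentiates {?m} x y"
  define m where "m = ?m"
  have neq: "m x \<noteq> m y"
    using \<open>differentiates {?m} x y\<close> by (simp add: differentiates_def m_def)
  let ?P = "degree_mpnn F f"
  have d: "hdim ?P (depth ?P) = 1"
    by (simp add: degree_mpnn_def)
  \<comment> \<open>The output dimension is 1, so the Hadamard block is coordinate 0 and the sum is
    coordinate 1.\<close>
  have "m z = ncn_repr ?P z $ 1" if "z \<in> links F" for z
  proof -
    obtain A X i j where z: "z = ((A, X), i, j)"
      by (cases z) auto
    have "(A, X) \<in> graphs F"
      using that by (auto simp: z links_def)
    then have "mpnn_out ?P (A, X) u $ 0 = f (real (degree A u))"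
      if "u \<in> nbrs A i \<inter> nbrs A j" for u
      using that by (intro degree_mpnn_out) (auto simp: nbrs_def)
    then show ?thesis
      using ncn_repr_sum[OF degree_mpnn_wf that[unfolded z], of 0 f] by (simp add: m_def z d)
  qed
  then have "ncn_repr ?P x \<noteq> ncn_repr ?P y"
    using neq x y by metis
  then show "differentiates (ncn F) x y"
    by (rule ncn_reprI[OF degree_mpnn_wf])
qed

text \<open>
  The network run on the quotient by an equitable partition: \<open>r t\<close> is the feature of the nodes of
  colour \<open>t\<close>, and \<open>M t\<close> the multiset of colours of their neighbours.
\<close>

primrec quotient_hidden ::
  "mpnn \<Rightarrow> ('c \<Rightarrow> real vec) \<Rightarrow> ('c \<Rightarrow> 'c multiset) \<Rightarrow> nat \<Rightarrow> 'c \<Rightarrow> real vec" where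
  "quotient_hidden P r M 0 t = r t"
| "quotient_hidden P r M (Suc k) t =
     upd P (Suc k) (quotient_hidden P r M k t)
       (agg P (mdim P (Suc k))
         {# msg P (Suc k) (quotient_hidden P r M k t) (quotient_hidden P r M k s). s \<in># M t #})"

text \<open>By induction on the layer the state of a node depends only on its colour: equal colours
  see equal multisets of messages. Hence two graphs that share \<open>r\<close> and \<open>M\<close>
  give nodes of equal colour equal states.\<close>

lemma mpnn_hidden_quotient:
  assumes "\<And>v. v < dim_row A \<Longrightarrow> row X v = r (c v)"
    and "\<And>v. v < dim_row A \<Longrightarrow> image_mset c (mset_set (nbrs A v)) = M (c v)"
    and "v < dim_row A"
  shows "mpnn_hidden P (A, X) k v = quotient_hidden P r M k (c v)"
  using assms(3)
proof (induction k arbitrary: v)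
  case 0
  then show ?case
    by (simp add: assms(1))
next
  case (Suc k)
  have "{# msg P (Suc k) h (mpnn_hidden P (A, X) k u). u \<in># mset_set (nbrs A v) #} =
      {# msg P (Suc k) h (quotient_hidden P r M k (c u)). u \<in># mset_set (nbrs A v) #}" for h
    using Suc.IH by (intro image_mset_cong) (auto simp: nbrs_def)
  also have "\<dots> h = {# msg P (Suc k) h (quotient_hidden P r M k s). s \<in># M (c v) #}" for h
    by (simp flip: assms(2)[OF Suc.prems] add: multiset.map_comp comp_def)
  finally show ?case
    by (simp add: Suc)
qed

section \<open>The separating pair of links on the 8-cycle\<close>

definition octagon :: "nat mat" where
  "octagon = mat 8 8 (\<lambda>(u, v). if u = (v + 1) mod 8 \<or> v = (u + 1) mod 8 then 1 else 0)"

text \<open>For \<open>s\<close> equal to 1 or 3 the marked nodes are \<open>s\<close> and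
  \<open>s + 4\<close>. Alternation on the odd nodes needs a length divisible by 4, and in the
  4-cycle both odd nodes would be common neighbours of 0 and 2; so 8 is the least length.\<close>

definition marks :: "nat \<Rightarrow> nat \<Rightarrow> real mat" where
  "marks F s = mat 8 F (\<lambda>(v, _). if v mod 4 = s then 1 else 0)"

definition octagon_link :: "nat \<Rightarrow> nat \<Rightarrow> link" where
  "octagon_link F s = ((octagon, marks F s), 0, 2)"

lemma dim_row_octagon [simp]: "dim_row octagon = 8"
  by (simp add: octagon_def)

lemma octagon_link_in_links: "octagon_link F s \<in> links F"
proof -
  have "elements_mat octagon \<subseteq> {0, 1}" "transpose_mat octagon = octagon"
    by (auto simp: octagon_def dest!: elements_matD intro!: eq_matI split: if_splits)
  moreover have "octagon \<in> carrier_mat 8 8" "marks F s \<in> carrier_mat 8 F"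
    by (simp_all add: octagon_def marks_def)
  ultimately show ?thesis
    by (auto simp: octagon_link_def links_def graphs_def)
qed

lemma less_8_cases: "(v::nat) < 8 \<Longrightarrow> v \<in> {0, 1, 2, 3, 4, 5, 6, 7}"
  by auto

lemma nbrs_octagon:
  assumes "v < 8"
  shows "nbrs octagon v = {(v + 1) mod 8, (v + 7) mod 8}"
proof -
  have "u \<in> nbrs octagon v \<longleftrightarrow> u \<in> {(v + 1) mod 8, (v + 7) mod 8}" if "u < 8" for u
  proof -
    \<comment> \<open>Adding 7 is the predecessor modulo 8, free of truncated subtraction; both
      wrap-arounds are made explicit.\<close>
    have "(u + 1) mod 8 = (if u = 7 then 0 else u + 1)"
      using that by (auto intro: mod_less)
    moreover have "(v + 7) mod 8 = (if v = 0 then 7 else v - 1)"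
      using assms by (cases v) auto
    ultimately have "v = (u + 1) mod 8 \<longleftrightarrow> u = (v + 7) mod 8"
      using assms that by auto
    then show ?thesis
      using assms that by (auto simp: nbrs_def octagon_def)
  qed
  moreover have "nbrs octagon v \<subseteq> {..<8}" "{(v + 1) mod 8, (v + 7) mod 8} \<subseteq> {..<8}"
    by (auto simp: nbrs_def)
  ultimately show ?thesis
    by blast
qed

definition octagon_colour :: "nat \<Rightarrow> nat \<Rightarrow> nat" where
  "octagon_colour s v = (if even v then 0 else if v mod 4 = s then 1 else 2)"

text \<open>The colours even, marked odd and unmarked odd form an equitable partition. On the right,
  \<open>s\<close> enters only through the colour of \<open>v\<close>, so both graphs have the same
  quotient.\<close>

lemma mpnn_out_octagon:
  assumes "s \<in> {1, 3}" "v < 8"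
  shows "mpnn_out P (octagon, marks F s) v =
    quotient_hidden P (\<lambda>t. vec F (\<lambda>_. if t = 1 then 1 else 0))
      (\<lambda>t. if t = 0 then {#1, 2#} else {#0, 0#}) (depth P) (octagon_colour s v)"
  unfolding mpnn_out_def
proof (rule mpnn_hidden_quotient)
  fix v assume "v < dim_row octagon"
  then have v: "v < 8"
    by simp
  show "row (marks F s) v = vec F (\<lambda>_. if octagon_colour s v = 1 then 1 else 0)"
    using assms(1) less_8_cases[OF v]
    by (intro eq_vecI) (auto simp: marks_def octagon_colour_def)
  show "image_mset (octagon_colour s) (mset_set (nbrs octagon v)) =
      (if octagon_colour s v = 0 then {#1, 2#} else {#0, 0#})"
    using assms(1) less_8_cases[OF v]
    by (auto simp: nbrs_octagon octagon_colour_def)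
qed (use assms in simp)

lemma mpnn_out_octagon_even:
  assumes "even v" "v < 8"
  shows "mpnn_out P (octagon, marks F 1) v = mpnn_out P (octagon, marks F 3) v"
  using assms by (simp add: mpnn_out_octagon octagon_colour_def)

lemma ncn_differentiates_octagon:
  assumes "F \<ge> 1"
  shows "differentiates (ncn F) (octagon_link F 1) (octagon_link F 3)"
proof -
  \<comment> \<open>A network without layers returns the raw features, so the sum block is the
    feature of node 1.\<close>
  define P where "P = \<lparr>depth = 0, hdim = (\<lambda>_. F), mdim = (\<lambda>_. 0), adim = (\<lambda>_. 0),
     msg = (\<lambda>_ _ _. 0\<^sub>v 0), agg = (\<lambda>_ _. 0\<^sub>v 0), upd = (\<lambda>_ h _. h)\<rparr>"
  have P: "mpnn_wf F P"
    by (auto simp: mpnn_wf_def P_def)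
  have d: "hdim P (depth P) = F"
    by (simp add: P_def)
  have common: "nbrs octagon 0 \<inter> nbrs octagon 2 = {1}"
    by (auto simp: nbrs_octagon)
  \<comment> \<open>Coordinate \<open>F\<close> is the first of the sum block; it exists because
    \<open>F \<ge> 1\<close>.\<close>
  have "ncn_repr P (octagon_link F s) $ F = (if s = 1 then 1 else 0)" for s
    using ncn_repr_sum[OF P octagon_link_in_links[of F s, unfolded octagon_link_def], of 0] assms
    by (simp add: d common octagon_link_def mpnn_out_def P_def marks_def)
  then have "ncn_repr P (octagon_link F 1) $ F \<noteq> ncn_repr P (octagon_link F 3) $ F"
    by simp
  then show ?thesis
    using ncn_reprI[OF P] by metis
qed

lemma not_differentiates_octagon:
  "\<not> differentiates (gae F) (octagon_link F 1) (octagon_link F 3)"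
  "\<not> differentiates cn (octagon_link F 1) (octagon_link F 3)"
  "\<not> differentiates ra (octagon_link F 1) (octagon_link F 3)"
  "\<not> differentiates aa (octagon_link F 1) (octagon_link F 3)"
  "\<not> differentiates (neo_gnn F) (octagon_link F 1) (octagon_link F 3)"
  "\<not> differentiates (buddy F) (octagon_link F 1) (octagon_link F 3)"
  \<comment> \<open>Networks are evaluated only at the even nodes 0 and 2. Without
    \<open>One_nat_def\<close> the term \<open>marks F 1\<close> keeps the form in which
    \<open>mpnn_out_octagon_even\<close> rewrites it.\<close>
  by (auto simp: differentiates_def octagon_link_def gae_def cn_def ra_def aa_def neo_gnn_def
      buddy_def mpnn_out_octagon_even simp del: One_nat_def)

theorem theorem2:
  fixes F :: nat
  assumes "F \<ge> 1"
  shows "strictly_more_expressive (links F) (ncn F) (gae F) \<and>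
         strictly_more_expressive (links F) (ncn F) cn \<and>
         strictly_more_expressive (links F) (ncn F) ra \<and>
         strictly_more_expressive (links F) (ncn F) aa \<and>
         \<not> more_expressive (links F) (neo_gnn F) (ncn F) \<and>
         \<not> more_expressive (links F) (buddy F) (ncn F)"
proof -
  have "more_expressive (links F) (ncn F) cn"
    using ncn_more_expressive_degree[of F "\<lambda>_. 1"] by (simp add: cn_def)
  moreover have "more_expressive (links F) (ncn F) ra"
    using ncn_more_expressive_degree[of F "\<lambda>d. 1 / d"] by (simp add: ra_def)
  moreover have "more_expressive (links F) (ncn F) aa"
    using ncn_more_expressive_degree[of F "\<lambda>d. 1 / ln d"] by (simp add: aa_def)
  ultimately show ?thesis
    using ncn_more_expressive_gae ncn_differentiates_octagon[OF assms]
      not_differentiates_octagon octagon_link_in_links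
    unfolding strictly_more_expressive_def more_expressive_def by blast
qed

end
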